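(* Let $T$ be a $3\times3$ complex matrix, and let $A=\frac12(T+T^* )$ and $B=\frac1{2i}(T-T^* )$. (1) If $A$ or $B$ has a repeated eigenvalue, then $T$ is unitarily equivalent to a complex symmetric matrix. (2) Suppose neither $A$ nor $B$ has a repeated eigenvalue. Let $\{g_1,g_2,g_3\}$ and $\{h_1,h_2,h_3\}$ be arbitrary bases of $\mathbb{C}^3$ consisting of eigenvectors of $A$ and of $B$, respectively, and let $M=(m_{i,j})=(\langle g_i,h_j\rangle)_{i,j=1}^3$. If $M$ has more than one entry equal to $0$, then $T$ is unitarily equivalent to a complex symmetric matrix. (3) Suppose, in the situation of (2), that $M$ has at most one entry equal to $0$. Then $\{g_i\}$ and $\{h_j\}$ can be reordered so that no zero entry of $M$ lies in the first row or first column. After any such reordering, and after replacing $g_1$ by $\frac{|\langle g_1,h_1\rangle|}{\langle g_1,h_1\rangle}\,g_1$ (with $M$ now denoting the matrix $(\langle g_i,h_j\rangle)_{i,j=1}^3$ of the resulting vectors), $T$ is unitarily equivalent to a complex symmetric matrix if and only if $$\frac{m_{i,j}}{m_{1,j}\,m_{i,1}}\in\mathbb{R}\qquad\text{for all } 2\le i,j\le 3.$$ (4) In the situation of (3), if $T$ is unitarily equivalent to a complex symmetric matrix, normalize the vectors $g_i$ to have norm $1$ and multiply $g_2$ and $g_3$ by unimodular constants so that $\langle g_i,h_1\rangle\in\mathbb{R}$ for all $i$, and let $U$ be the matrix with columns $g_1,g_2,g_3$. Then $U^*TU$ is complex symmetric, and $T$ is $C$-symmetric with respect to the conjugation $Cx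=UU^t\overline{x}$.
   Context: A complex symmetric matrix is an $n\times n$ matrix $S$ with complex entries such that $S=S^t$ (transpose, no conjugation). A matrix $T$ is unitarily equivalent to $S$ if $S=U^*TU$ for some unitary $U$. $\langle\cdot,\cdot\rangle$ is the standard inner product on $\mathbb{C}^n$, linear in the first argument and conjugate-linear in the second. A conjugation on $\mathbb{C}^n$ is a conjugate-linear map $C:\mathbb{C}^n\to\mathbb{C}^n$ with $C^2=I$ and $\langle x,y\rangle=\langle Cy,Cx\rangle$ for all $x,y$. A linear operator (matrix) $T$ is $C$-symmetric if $T=CT^*C$. $\overline{x}$ denotes the coordinatewise complex conjugate of $x$. *)

theory Defs
  imports "HOL-Analysis.Analysis" "HOL-Computational_Algebra.Polynomial"
begin

text \<open>The library's inner product on \<^typ>\<open>complex^'n\<close> is the real-valued one (the real part of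
  the function below); its norm agrees with the norm induced by \<open>cinner\<close>.\<close>

definition cinner :: "complex^'n \<Rightarrow> complex^'n \<Rightarrow> complex" where
  "cinner x y = (\<Sum>k\<in>UNIV. x $ k * cnj (y $ k))"

definition cnj_vec :: "complex^'n \<Rightarrow> complex^'n" where
  "cnj_vec x = (\<chi> k. cnj (x $ k))"

definition ctranspose :: "complex^'n^'m \<Rightarrow> complex^'m^'n" where
  "ctranspose A = map_matrix cnj (transpose A)"

definition unitary :: "complex^'n^'n \<Rightarrow> bool" where
  "unitary U \<longleftrightarrow> ctranspose U ** U = mat 1 \<and> U ** ctranspose U = mat 1"

definition complex_symmetric :: "complex^'n^'n \<Rightarrow> bool" where
  "complex_symmetric S \<longleftrightarrow> S = transpose S"

definition unitarily_equivalent :: "complex^'n^'n \<Rightarrow> complex^'n^'n \<Rightarrow> bool" where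
  "unitarily_equivalent T S \<longleftrightarrow> (\<exists>U. unitary U \<and> S = ctranspose U ** T ** U)"

text \<open>UECSM: unitarily equivalent to a complex symmetric matrix.\<close>

definition UECSM :: "complex^'n^'n \<Rightarrow> bool" where
  "UECSM T \<longleftrightarrow> (\<exists>S. complex_symmetric S \<and> unitarily_equivalent T S)"

definition conjugation :: "(complex^'n \<Rightarrow> complex^'n) \<Rightarrow> bool" where
  "conjugation C \<longleftrightarrow>
     (\<forall>x y. C (x + y) = C x + C y) \<and>
     (\<forall>a x. C (a *s x) = cnj a *s C x) \<and>
     (\<forall>x. C (C x) = x) \<and>
     (\<forall>x y. cinner x y = cinner (C y) (C x))"

definition C_symmetric :: "(complex^'n \<Rightarrow> complex^'n) \<Rightarrow> complex^'n^'n \<Rightarrow> bool" where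
  "C_symmetric C T \<longleftrightarrow> (\<forall>x. T *v x = C (ctranspose T *v C x))"

definition eigenvector :: "complex^'n^'n \<Rightarrow> complex^'n \<Rightarrow> bool" where
  "eigenvector A v \<longleftrightarrow> v \<noteq> 0 \<and> (\<exists>k. A *v v = k *s v)"

text \<open>The characteristic polynomial \<open>det (x I - A)\<close>, as a determinant over \<^typ>\<open>complex poly\<close>.\<close>

definition charpoly :: "complex^'n^'n \<Rightarrow> complex poly" where
  "charpoly A = det (mat [:0, 1:] - map_matrix (\<lambda>a. [:a:]) A)"

text \<open>Eigenvalues are repeated according to algebraic multiplicity; for the self-adjoint matrices
  to which this is applied, algebraic and geometric multiplicity coincide.\<close>

definition has_repeated_eigenvalue :: "complex^'n^'n \<Rightarrow> bool" where
  "has_repeated_eigenvalue A \<longleftrightarrow> (\<exists>k. order k (charpoly A) \<ge> 2)"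

text \<open>Here \<open>vec.independent\<close> and \<open>vec.span\<close> are linear independence and span over the complex
  scalars; plain \<open>independent\<close> and \<open>span\<close> would be over the reals.\<close>

definition eigenbasis :: "complex^'n^'n \<Rightarrow> ('n \<Rightarrow> complex^'n) \<Rightarrow> bool" where
  "eigenbasis A g \<longleftrightarrow>
     inj g \<and> vec.independent (range g) \<and> vec.span (range g) = UNIV \<and> (\<forall>i. eigenvector A (g i))"

definition cross_gram :: "('n \<Rightarrow> complex^'n) \<Rightarrow> ('n \<Rightarrow> complex^'n) \<Rightarrow> complex^'n^'n" where
  "cross_gram g h = (\<chi> i j. cinner (g i) (h j))"

definition zero_entries :: "complex^'n^'m \<Rightarrow> ('m \<times> 'n) set" where
  "zero_entries M = {(i, j). M $ i $ j = 0}"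

definition first_row_col_nonzero :: "complex^3^3 \<Rightarrow> bool" where
  "first_row_col_nonzero M \<longleftrightarrow> (\<forall>j. M $ 1 $ j \<noteq> 0) \<and> (\<forall>i. M $ i $ 1 \<noteq> 0)"

definition rephase_first :: "(3 \<Rightarrow> complex^3) \<Rightarrow> (3 \<Rightarrow> complex^3) \<Rightarrow> (3 \<Rightarrow> complex^3)" where
  "rephase_first g h =
     g(1 := (complex_of_real (cmod (cinner (g 1) (h 1))) / cinner (g 1) (h 1)) *s g 1)"

definition unit_vec :: "complex^'n \<Rightarrow> complex^'n" where
  "unit_vec v = (1 / norm v) *\<^sub>R v"

definition matrix_of_columns :: "('n \<Rightarrow> complex^'m) \<Rightarrow> complex^'n^'m" where
  "matrix_of_columns g = (\<chi> i j. g j $ i)"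

text \<open>Unimodular multipliers \<open>c\<close>, leaving the first vector unchanged, that make all
  \<open>\<langle>c\<^sub>i g\<^sub>i, h\<^sub>1\<rangle>\<close> real.\<close>

definition realigning :: "(3 \<Rightarrow> complex^3) \<Rightarrow> (3 \<Rightarrow> complex^3) \<Rightarrow> (3 \<Rightarrow> complex) \<Rightarrow> bool" where
  "realigning g h c \<longleftrightarrow>
     c 1 = 1 \<and> (\<forall>i. cmod (c i) = 1) \<and> (\<forall>i. cinner (c i *s g i) (h 1) \<in> \<real>)"

end

theory Submission
  imports Defs
begin

text \<open>
Write \<open>T = A + \<i> B\<close> and let \<open>e\<close>, \<open>f\<close> be orthonormal bases of eigenvectors of the self-adjoint matrices
\<open>A\<close> and \<open>B\<close>. Each \<open>e i\<close> and \<open>f j\<close> may be multiplied by a unimodular constant; when both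
spectra are simple, everything depends on whether this can make all inner products \<open>\<langle>e i, f j\<rangle>\<close> real. If it can, then in the basis \<open>e\<close>
the matrix \<open>A\<close> is diagonal and \<open>B\<close>, whose eigenvectors have real coordinates, is symmetric, and so is \<open>T\<close>
(\<open>real_gram_imp_symmetric\<close>).

Conversely, a symmetric representation \<open>U\<^sup>* T U\<close> yields the conjugation \<open>C x = U U\<^sup>t (cnj x)\<close> with
\<open>T = C T\<^sup>* C\<close> (\<open>symmetric_imp_conjugation\<close>). It commutes with \<open>A\<close> and \<open>B\<close>. When their spectra are
simple it therefore multiplies every eigenvector by a constant, so that
\<open>\<langle>g i, h j\<rangle> = a i * b j * cnj \<langle>g i, h j\<rangle>\<close>, and the cross ratios of the Gram matrix are real
(\<open>UECSM_imp_ratio_real\<close>). This is the stated condition, because the entry at \<open>(1, 1)\<close> has been made real.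

In dimension three the phases can be corrected in three ways. If \<open>A\<close> or \<open>B\<close> has a repeated eigenvalue, it
is a multiple of the identity plus a matrix of rank at most one, and only one row or column of inner products
needs to be real (\<open>repeated_eigenvalue_UECSM\<close>). If the Gram matrix has two zeros, unitarity forces a
permuted block form with blocks of size one and two, and orthogonality of the rows of the larger block lets its
phases be removed (\<open>two_zeros_rephasable\<close>). Otherwise the first row and the first column can be made
real, and the ratio condition says that the other four entries are then real as well
(\<open>realigned_columns_symmetric\<close>).

The existence of orthonormal eigenvectors is proved from the maximum of the Rayleigh quotient
(\<open>hermitian_orthonormal_eigenvectors\<close>), and multiplicities in the characteristic polynomial are compared
with the eigenvalues of a basis of eigenvectors (\<open>has_repeated_eigenvalue_iff\<close>).
\<close>

section \<open>The complex inner product\<close>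

lemma cinner_add_left: "cinner (x + y) z = cinner x z + cinner y z"
  by (simp add: cinner_def sum.distrib distrib_right)

lemma cinner_diff_left: "cinner (x - y) z = cinner x z - cinner y z"
  by (simp add: cinner_def sum_subtractf left_diff_distrib)

lemma cinner_scale_left: "cinner (a *s x) y = a * cinner x y"
  by (simp add: cinner_def sum_distrib_left mult.assoc)

lemma cinner_scale_right: "cinner x (a *s y) = cnj a * cinner x y"
  by (simp add: cinner_def sum_distrib_left algebra_simps)

lemma cinner_sum_left: "cinner (\<Sum>p\<in>J. x p) y = (\<Sum>p\<in>J. cinner (x p) y)"
  by (simp add: cinner_def sum_distrib_right) (rule sum.swap)

lemma cnj_cinner: "cnj (cinner x y) = cinner y x"
  by (simp add: cinner_def mult.commute)

lemma cinner_eq_0_sym: "cinner x y = 0 \<longleftrightarrow> cinner y x = 0"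
  by (metis cnj_cinner complex_cnj_zero_iff)

lemma Re_cinner: "Re (cinner x y) = x \<bullet> y"
  by (simp add: cinner_def inner_vec_def inner_complex_def)

lemma cinner_self: "cinner x x = complex_of_real ((norm x)\<^sup>2)"
proof (rule complex_eqI)
  show "Re (cinner x x) = Re (complex_of_real ((norm x)\<^sup>2))"
    by (simp add: Re_cinner power2_norm_eq_inner)
  show "Im (cinner x x) = Im (complex_of_real ((norm x)\<^sup>2))"
    using arg_cong[OF cnj_cinner[of x x], of Im] by simp
qed

lemma cinner_adjoint: "cinner (A *v x) y = cinner x (ctranspose A *v y)"
  unfolding cinner_def ctranspose_def matrix_vector_mult_def
  by (simp add: transpose_def sum_distrib_left sum_distrib_right mult_ac) (rule sum.swap)

lemma matrix_vector_sum: "(A :: complex^'n^'m) *v (\<Sum>p\<in>J. x p) = (\<Sum>p\<in>J. A *v x p)"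
  by (induction J rule: infinite_finite_induct) (simp_all add: matrix_vector_right_distrib)

section \<open>Orthonormal families and the spectral theorem\<close>

definition orthonormal_family :: "('n \<Rightarrow> complex^'n) \<Rightarrow> bool" where
  "orthonormal_family e \<longleftrightarrow> (\<forall>i j. cinner (e i) (e j) = (if i = j then 1 else 0))"

lemma unitary_columns: "unitary (matrix_of_columns e) \<longleftrightarrow> orthonormal_family e"
proof -
  have entry: "(ctranspose (matrix_of_columns e) ** matrix_of_columns e) $ i $ j = cinner (e j) (e i)"
    for i j
    by (simp add: ctranspose_def matrix_of_columns_def matrix_matrix_mult_def transpose_def cinner_def
        mult.commute)
  have "ctranspose (matrix_of_columns e) ** matrix_of_columns e = mat 1 \<longleftrightarrow> orthonormal_family e"
    by (auto simp: vec_eq_iff entry orthonormal_family_def mat_def)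
  then show ?thesis
    by (auto simp: unitary_def matrix_left_right_inverse)
qed

lemma orthonormal_expansion:
  assumes "orthonormal_family e"
  shows "x = (\<Sum>p\<in>UNIV. cinner x (e p) *s e p)"
proof -
  let ?U = "matrix_of_columns e"
  have "x = ?U *v (ctranspose ?U *v x)"
    using assms by (simp add: matrix_vector_mul_assoc unitary_columns[symmetric] unitary_def)
  also have "\<dots> = (\<Sum>p\<in>UNIV. (ctranspose ?U *v x) $ p *s e p)"
    by (simp add: matrix_vector_mult_def vec_eq_iff matrix_of_columns_def mult.commute)
  also have "\<dots> = (\<Sum>p\<in>UNIV. cinner x (e p) *s e p)"
    by (simp add: matrix_vector_mult_def ctranspose_def transpose_def matrix_of_columns_def
        cinner_def mult.commute)
  finally show ?thesis .
qed

lemma orthonormal_Parseval: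
  assumes "orthonormal_family e"
  shows "cinner x y = (\<Sum>p\<in>UNIV. cinner x (e p) * cnj (cinner y (e p)))"
proof -
  have "cinner x y = cinner (\<Sum>p\<in>UNIV. cinner x (e p) *s e p) y"
    using orthonormal_expansion[OF assms] by metis
  then show ?thesis
    by (simp add: cinner_sum_left cinner_scale_left cnj_cinner)
qed

text \<open>Spectral form of the sesquilinear form of a matrix diagonalised by \<open>f\<close>; the eigenvalues \<open>l\<close> are
arbitrary complex numbers, so that it covers the skew-adjoint matrix \<open>\<i> B\<close> as well as \<open>A\<close>.\<close>

lemma matrix_vector_orthonormal_expansion:
  assumes "orthonormal_family f" "\<And>p. A *v f p = l p *s f p"
  shows "cinner (A *v x) y = (\<Sum>p\<in>UNIV. l p * cinner x (f p) * cnj (cinner y (f p)))"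
proof -
  have "A *v x = A *v (\<Sum>p\<in>UNIV. cinner x (f p) *s f p)"
    using orthonormal_expansion[OF assms(1)] by metis
  then show ?thesis
    by (simp add: matrix_vector_sum vector_scalar_commute assms(2)
        cinner_sum_left cinner_scale_left cnj_cinner mult_ac)
qed

text \<open>A maximiser of the Rayleigh quotient on the compact unit sphere of \<open>W\<close> is an eigenvector: its residual
\<open>r = A x - m x\<close> again lies in \<open>W\<close>, and moving \<open>x\<close> in the direction \<open>r\<close> would increase the quotient
at the rate \<open>2 (r \<bullet> r)\<close> to first order.\<close>

lemma hermitian_eigenvector_in_invariant:
  fixes A :: "complex^'n^'n"
  assumes herm: "ctranspose A = A"
    and lin: "\<And>x y. x \<in> W \<Longrightarrow> y \<in> W \<Longrightarrow> x + y \<in> W" "\<And>a x. x \<in> W \<Longrightarrow> a *s x \<in> W"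
    and inv: "\<And>x. x \<in> W \<Longrightarrow> A *v x \<in> W"
    and closed: "closed W"
    and w: "w \<in> W" "w \<noteq> 0"
  shows "\<exists>x\<in>W. \<exists>m. norm x = 1 \<and> A *v x = complex_of_real m *s x"
proof -
  have scaleR: "r *\<^sub>R x = complex_of_real r *s x" for r and x :: "complex^'n"
    by (simp add: vec_eq_iff) (simp add: scaleR_conv_of_real)
  have linR: "r *\<^sub>R x \<in> W" if "x \<in> W" for r x
    using lin(2)[OF that] by (simp add: scaleR)
  let ?K = "sphere 0 1 \<inter> W"
  have comp: "compact ?K"
    using closed by (intro compact_Int_closed compact_sphere)
  have "(1 / norm w) *\<^sub>R w \<in> ?K"
    using w linR by simp
  then have ne: "?K \<noteq> {}" by blast
  have bl: "bounded_linear (\<lambda>x. A *v x)"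
    by (rule matrix_vector_mul_bounded_linear)
  have "continuous_on ?K (\<lambda>x. (A *v x) \<bullet> x)"
    by (intro continuous_intros bounded_linear.continuous_on[OF bl])
  from continuous_attains_sup[OF comp ne this]
  obtain x where x: "x \<in> ?K" and max: "\<And>y. y \<in> ?K \<Longrightarrow> (A *v y) \<bullet> y \<le> (A *v x) \<bullet> x"
    by blast
  define m where "m = (A *v x) \<bullet> x"
  have nx: "norm x = 1" and xW: "x \<in> W" using x by auto
  have hom: "(A *v y) \<bullet> y \<le> m * (y \<bullet> y)" if "y \<in> W" for y
  proof (cases "y = 0")
    case False
    let ?z = "(1 / norm y) *\<^sub>R y"
    have "?z \<in> ?K" using False that linR by simp
    then have "(A *v ?z) \<bullet> ?z \<le> m" unfolding m_def by (rule max)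
    also have "(A *v ?z) \<bullet> ?z = ((A *v y) \<bullet> y) / (y \<bullet> y)"
      by (simp add: linear_cmul[OF bounded_linear.linear[OF bl]] dot_square_norm power2_eq_square)
    finally show ?thesis
      using False by (simp add: divide_simps split: if_splits)
  qed simp
  define r where "r = A *v x - m *\<^sub>R x"
  have rW: "r \<in> W"
    using lin(1)[OF inv[OF xW] linR[OF xW, of "-m"]] by (simp add: r_def)
  have sym: "(A *v y) \<bullet> z = y \<bullet> (A *v z)" for y z
    using cinner_adjoint[of A y z] herm by (metis Re_cinner)
  \<comment> \<open>The maximum property at \<open>x + t r\<close> bounds a term linear in \<open>t\<close> by a quadratic one, so small \<open>t > 0\<close>
    force \<open>r = 0\<close>.\<close>
  have quad: "2 * t * (r \<bullet> r) \<le> t\<^sup>2 * (m * (r \<bullet> r) - (A *v r) \<bullet> r)" for t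
  proof -
    have "x + t *\<^sub>R r \<in> W" using lin(1) linR xW rW by blast
    from hom[OF this]
    have "(A *v x) \<bullet> x + 2 * t * ((A *v x) \<bullet> r) + t\<^sup>2 * ((A *v r) \<bullet> r)
        \<le> m * (x \<bullet> x + 2 * t * (x \<bullet> r) + t\<^sup>2 * (r \<bullet> r))"
      using sym[of r x]
      by (simp add: linear_add[OF bounded_linear.linear[OF bl]]
          linear_cmul[OF bounded_linear.linear[OF bl]] inner_add_left inner_add_right
          power2_eq_square inner_commute algebra_simps)
    moreover have "(A *v x) \<bullet> r = r \<bullet> r + m * (x \<bullet> r)"
      by (simp add: r_def inner_diff_left inner_diff_right algebra_simps)
    moreover have "x \<bullet> x = 1" using nx by (simp add: dot_square_norm)
    ultimately show ?thesis
      by (simp add: m_def algebra_simps)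
  qed
  have "r \<bullet> r = 0"
  proof (rule ccontr)
    assume "r \<bullet> r \<noteq> 0"
    then have pos: "r \<bullet> r > 0" using inner_ge_zero[of r] by linarith
    define K where "K = m * (r \<bullet> r) - (A *v r) \<bullet> r"
    define t where "t = (r \<bullet> r) / (\<bar>K\<bar> + 1)"
    have tp: "t > 0" using pos by (simp add: t_def add_nonneg_pos)
    have "2 * t * (r \<bullet> r) \<le> t * (t * K)"
      using quad[of t] by (simp add: K_def power2_eq_square mult.assoc)
    then have "2 * (r \<bullet> r) \<le> t * K" using tp by (simp add: mult.assoc)
    also have "\<dots> \<le> t * (\<bar>K\<bar> + 1)" using tp by (intro mult_left_mono) auto
    also have "\<dots> = r \<bullet> r" by (simp add: t_def)
    finally show False using pos by simp
  qed
  then have "A *v x = complex_of_real m *s x"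
    by (simp add: r_def scaleR)
  then show ?thesis using xW nx by blast
qed

text \<open>The spectral theorem. The induction runs over the set of indices that already carry an eigenvector: fewer
than \<open>n\<close> vectors do not span the space, so their orthogonal complement, which is invariant under the
self-adjoint \<open>A\<close>, contains a nonzero vector and hence a further unit eigenvector.\<close>

lemma hermitian_orthonormal_eigenvectors:
  fixes A :: "complex^'n^'n"
  assumes herm: "ctranspose A = A"
  shows "\<exists>e k. orthonormal_family e \<and> (\<forall>i. A *v e i = complex_of_real (k i) *s e i)"
proof -
  have "\<exists>e k. (\<forall>i\<in>J. \<forall>j\<in>J. cinner (e i) (e j) = (if i = j then 1 else 0)) \<and>
      (\<forall>i\<in>J. A *v e i = complex_of_real (k i) *s e i)" for J :: "'n set"
  proof (induction J rule: finite_induct[OF finite])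
    case (2 q J)
    then obtain e k where on: "\<And>i j. i \<in> J \<Longrightarrow> j \<in> J \<Longrightarrow> cinner (e i) (e j) = (if i = j then 1 else 0)"
      and ev: "\<And>i. i \<in> J \<Longrightarrow> A *v e i = complex_of_real (k i) *s e i" by blast
    define W where "W = {x. \<forall>i\<in>J. cinner x (e i) = 0}"
    have inv: "A *v x \<in> W" if "x \<in> W" for x
      using that ev by (simp add: W_def cinner_adjoint herm cinner_scale_right)
    have "closed {x. cinner x (e i) = 0}" for i
      unfolding cinner_def by (intro closed_Collect_eq continuous_intros)
    then have "closed (\<Inter>i\<in>J. {x. cinner x (e i) = 0})" by blast
    moreover have "W = (\<Inter>i\<in>J. {x. cinner x (e i) = 0})" by (auto simp: W_def)
    ultimately have cl: "closed W" by simp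
    have "\<exists>w\<in>W. w \<noteq> 0"
    proof -
      have "card (e ` J) < CARD('n)"
        using 2 card_image_le[of J e] psubset_card_mono[of UNIV J] by force
      then have "vec.span (e ` J) \<noteq> UNIV"
        using vec.dim_le_card[of "UNIV" "e ` J"] by (auto simp: card_cart_basis)
      then obtain x where x: "x \<notin> vec.span (e ` J)" by blast
      \<comment> \<open>Subtracting the orthogonal projection onto the span of the \<open>e p\<close>, as in Gram-Schmidt.\<close>
      define y where "y = (\<Sum>p\<in>J. cinner x (e p) *s e p)"
      have "y \<in> vec.span (e ` J)"
        unfolding y_def by (intro vec.span_sum vec.span_scale vec.span_base) auto
      then have "x - y \<noteq> 0" using x by auto
      moreover have "cinner y (e i) = cinner x (e i)" if "i \<in> J" for i
      proof -
        have "cinner y (e i) = (\<Sum>p\<in>J. if p = i then cinner x (e p) else 0)"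
          unfolding y_def cinner_sum_left cinner_scale_left
          using on that by (intro sum.cong) auto
        then show ?thesis using that by simp
      qed
      ultimately show ?thesis
        by (intro bexI[of _ "x - y"]) (auto simp: W_def cinner_diff_left)
    qed
    then obtain w where w: "w \<in> W" "w \<noteq> 0" by blast
    from hermitian_eigenvector_in_invariant[OF herm _ _ inv cl w]
    obtain x m where x: "x \<in> W" "norm x = 1" "A *v x = complex_of_real m *s x"
      by (auto simp: W_def cinner_add_left cinner_scale_left)
    have "cinner x x = 1" using x by (simp add: cinner_self)
    moreover have "cinner x (e i) = 0" "cinner (e i) x = 0" if "i \<in> J" for i
      using x(1) that cinner_eq_0_sym by (auto simp: W_def)
    ultimately show ?case
      using on ev x(3) 2(2)
      by (intro exI[of _ "e(q := x)"] exI[of _ "k(q := m)"]) auto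
  qed simp
  from this[of UNIV] show ?thesis
    by (auto simp: orthonormal_family_def)
qed

section \<open>Characteristic polynomial\<close>

text \<open>With \<open>G\<close> the matrix of columns \<open>g i\<close>, the relation \<open>A G = G D\<close> gives \<open>(x I - A) G = G (x I - D)\<close>
over the polynomial ring, and \<open>det G\<close> cancels because \<open>G\<close> is invertible.\<close>

lemma charpoly_eigenfamily:
  fixes A :: "complex^'n^'n" and g :: "'n \<Rightarrow> complex^'n"
  assumes ev: "\<And>i. A *v g i = k i *s g i"
    and inv: "matrix_of_columns g ** H = mat 1"
  shows "charpoly A = (\<Prod>i\<in>UNIV. [:- k i, 1:])"
proof -
  let ?c = "\<lambda>M. map_matrix (\<lambda>a::complex. [:a:]) M"
  let ?G = "matrix_of_columns g"
  let ?D = "(\<chi> i j. if i = j then [:- k i, 1:] else 0) :: complex poly^'n^'n"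
  have cmul: "?c (M ** N) = ?c M ** ?c N" for M N :: "complex^'n^'n"
  proof -
    have s: "[:\<Sum>i\<in>I. f i:] = (\<Sum>i\<in>I. [:f i:])" for f :: "'n \<Rightarrow> complex" and I
      by (rule poly_eqI) (simp add: coeff_sum coeff_pCons split: nat.split)
    show ?thesis
      by (simp add: vec_eq_iff matrix_matrix_mult_def s mult.commute)
  qed
  have c1: "?c (mat 1) = (mat 1 :: complex poly^'n^'n)"
    by (simp add: vec_eq_iff mat_def one_pCons)
  have distr: "(X - Y) ** Z = X ** Z - Y ** Z" for X Y Z :: "complex poly^'n^'n"
    by (simp add: vec_eq_iff matrix_matrix_mult_def left_diff_distrib sum_subtractf)
  have AG: "(\<Sum>p\<in>UNIV. A $ i $ p * g j $ p) = k j * g j $ i" for i j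
    using arg_cong[OF ev[of j], of "\<lambda>v. v $ i"]
    by (simp add: matrix_matrix_mult_def matrix_vector_mult_def matrix_of_columns_def)
  have "(mat [:0, 1:] - ?c A) ** ?c ?G = mat [:0, 1:] ** ?c ?G - ?c (A ** ?G)"
    by (simp add: cmul distr)
  also have "\<dots> = ?c ?G ** ?D"
    by (simp add: vec_eq_iff AG matrix_matrix_mult_def mat_def matrix_of_columns_def
        if_distrib[where f="\<lambda>x. x * y" for y] if_distrib[where f="\<lambda>x. y * x" for y]
        if_distrib[where f="smult y" for y] cong: if_cong)
  finally have "charpoly A * det (?c ?G) = det (?c ?G) * det ?D"
    unfolding charpoly_def by (simp flip: det_mul)
  moreover have "det (?c ?G) * det (?c H) = 1"
    by (simp flip: det_mul cmul add: inv c1)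
  then have "det (?c ?G) \<noteq> 0" by auto
  ultimately have "charpoly A = det ?D" by (simp add: mult.commute)
  also have "\<dots> = (\<Prod>i\<in>UNIV. [:- k i, 1:])"
    by (subst det_diagonal) auto
  finally show ?thesis .
qed

lemma order_prod_linear:
  fixes k :: "'n \<Rightarrow> complex"
  assumes "finite S"
  shows "order a (\<Prod>i\<in>S. [:- k i, 1:]) = card {i\<in>S. k i = a}"
  using assms
proof (induction S)
  case (insert q S)
  have ord: "order a [:- k q, 1:] = (if k q = a then 1 else 0)"
    using order_power_n_n[of a 1] by (auto intro: order_0I)
  have set: "{i \<in> insert q S. k i = a} = (if k q = a then {q} else {}) \<union> {i\<in>S. k i = a}"
    by auto
  have nz: "[:- k q, 1:] * (\<Prod>i\<in>S. [:- k i, 1:]) \<noteq> 0"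
    unfolding mult_eq_0_iff using insert(1) by simp
  with ord have "order a (\<Prod>i\<in>insert q S. [:- k i, 1:]) = (if k q = a then 1 else 0) + card {i\<in>S. k i = a}"
    by (simp only: prod.insert[OF insert(1,2)] order_mult[OF nz] insert(3))
  also have "\<dots> = card {i \<in> insert q S. k i = a}"
    using insert(1,2) by (subst set) (simp add: card_insert_if)
  finally show ?case .
qed simp

text \<open>This turns the algebraic multiplicities of the characteristic polynomial into a condition on the
eigenvalues of a given basis of eigenvectors.\<close>

lemma has_repeated_eigenvalue_iff:
  fixes A :: "complex^'n^'n" and g :: "'n \<Rightarrow> complex^'n"
  assumes "\<And>i. A *v g i = k i *s g i" "matrix_of_columns g ** H = mat 1"
  shows "has_repeated_eigenvalue A \<longleftrightarrow> \<not> inj k"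
proof -
  have "order a (charpoly A) = card {i. k i = a}" for a
    using order_prod_linear[of UNIV a k] charpoly_eigenfamily[OF assms] by simp
  moreover have "(\<exists>a. 2 \<le> card {i. k i = a}) \<longleftrightarrow> \<not> inj k"
  proof -
    have "2 \<le> card {i. k i = a} \<longleftrightarrow> (\<exists>x y. k x = a \<and> k y = a \<and> x \<noteq> y)" for a
      using card_le_Suc0_iff_eq[of "{i. k i = a}"] by (auto simp: not_less_eq_eq numeral_2_eq_2)
    then show ?thesis by (auto simp: inj_def)
  qed
  ultimately show ?thesis
    by (simp add: has_repeated_eigenvalue_def)
qed

section \<open>Self-adjoint matrices with simple spectrum\<close>

lemma hermitian_eigenvalue_real:
  assumes "ctranspose A = A" "A *v x = k *s x" "x \<noteq> 0"
  shows "cnj k = k"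
proof -
  have "k * cinner x x = cnj k * cinner x x"
    using cinner_adjoint[of A x x] assms by (simp add: cinner_scale_left cinner_scale_right)
  then show ?thesis using assms(3) by (simp add: cinner_self)
qed

lemma hermitian_eigenvectors_orthogonal:
  assumes A: "ctranspose A = A" and x: "A *v x = k *s x" and y: "A *v y = l *s y" "y \<noteq> 0" and kl: "k \<noteq> l"
  shows "cinner x y = 0"
proof -
  have "k * cinner x y = cnj l * cinner x y"
    using cinner_adjoint[of A x y] A x y by (simp add: cinner_scale_left cinner_scale_right)
  then show ?thesis using kl hermitian_eigenvalue_real[OF A y] by simp
qed

lemma unit_vec_scale: "unit_vec v = complex_of_real (1 / norm v) *s v"
  by (simp add: unit_vec_def vec_eq_iff) (simp add: scaleR_conv_of_real)

lemma orthonormal_family_unit_vec: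
  assumes nz: "\<And>i. g i \<noteq> 0" and orth: "\<And>i j. i \<noteq> j \<Longrightarrow> cinner (g i) (g j) = 0"
  shows "orthonormal_family (\<lambda>i. unit_vec (g i))"
  unfolding orthonormal_family_def
proof (intro allI)
  fix i j
  show "cinner (unit_vec (g i)) (unit_vec (g j)) = (if i = j then 1 else 0)"
    using nz[of i] orth[of i j]
    by (auto simp: unit_vec_scale cinner_scale_left cinner_scale_right cinner_self power2_eq_square)
qed

text \<open>What remains of an eigenbasis of a self-adjoint matrix with simple spectrum once its eigenvalues \<open>k\<close>
are named. The vectors themselves keep an arbitrary length, because the criterion is stated for
unnormalised eigenvectors.\<close>

definition simple_eigensystem :: "complex^'n^'n \<Rightarrow> ('n \<Rightarrow> complex^'n) \<Rightarrow> ('n \<Rightarrow> complex) \<Rightarrow> bool" where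
  "simple_eigensystem A g k \<longleftrightarrow>
     inj k \<and> (\<forall>i. A *v g i = k i *s g i) \<and> orthonormal_family (\<lambda>i. unit_vec (g i)) \<and> (\<forall>i. g i \<noteq> 0)"

lemma eigenbasis_simple_spectrum:
  fixes A :: "complex^'n^'n"
  assumes A: "ctranspose A = A" and g: "eigenbasis A g" and simple: "\<not> has_repeated_eigenvalue A"
  shows "\<exists>k. simple_eigensystem A g k"
proof -
  from g have nz: "\<And>i. g i \<noteq> 0" and "\<forall>i. \<exists>k. A *v g i = k *s g i"
    by (auto simp: eigenbasis_def eigenvector_def)
  then obtain k where ev: "\<And>i. A *v g i = k i *s g i" by metis
  have "columns (matrix_of_columns g) = range g"
    by (auto simp: columns_def column_def matrix_of_columns_def)
  then obtain H where "matrix_of_columns g ** H = mat 1"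
    using g matrix_right_invertible_span_columns[of "matrix_of_columns g"]
    by (auto simp: eigenbasis_def)
  then have "inj k" using has_repeated_eigenvalue_iff[of A g k H] ev simple by blast
  moreover from this have "cinner (g i) (g j) = 0" if "i \<noteq> j" for i j
    using hermitian_eigenvectors_orthogonal[OF A ev ev nz] that by (auto dest: injD)
  ultimately show ?thesis
    using nz ev orthonormal_family_unit_vec[of g] by (auto simp: simple_eigensystem_def)
qed

text \<open>Eigenspaces of a simple spectrum are lines: an eigenvector for \<open>k i\<close> is orthogonal to every other \<open>g p\<close>,
so only one term of its orthonormal expansion survives.\<close>

lemma simple_eigensystem_eigenvector:
  assumes A: "ctranspose A = A" and s: "simple_eigensystem A g k" and v: "A *v v = k i *s v"
  shows "\<exists>a. v = a *s g i"
proof -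
  let ?e = "\<lambda>i. unit_vec (g i)"
  have on: "orthonormal_family ?e" using s by (simp add: simple_eigensystem_def)
  have "cinner v (?e p) = 0" if "p \<noteq> i" for p
    using hermitian_eigenvectors_orthogonal[OF A v, of "g p" "k p"] s that
    by (auto simp: simple_eigensystem_def unit_vec_scale cinner_scale_right dest: injD)
  then have "(\<Sum>p\<in>UNIV. cinner v (?e p) *s ?e p) = (\<Sum>p\<in>UNIV. if p = i then cinner v (?e i) *s ?e i else 0)"
    by (intro sum.cong) auto
  then have "v = cinner v (?e i) *s ?e i"
    using orthonormal_expansion[OF on, of v] by simp
  then show ?thesis by (metis unit_vec_scale vector_smult_assoc)
qed

lemma eigenvector_scale: "A *v v = k *s v \<Longrightarrow> (A :: complex^'n^'n) *v (a *s v) = k *s (a *s v)"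
  by (simp add: vector_scalar_commute vector_smult_assoc mult.commute)

lemma eigenvector_unit_vec: "A *v v = k *s v \<Longrightarrow> (A :: complex^'n^'n) *v unit_vec v = k *s unit_vec v"
  unfolding unit_vec_scale by (rule eigenvector_scale)

lemma simple_eigensystem_reindex:
  assumes "simple_eigensystem A g k" "inj \<sigma>"
  shows "simple_eigensystem A (g \<circ> \<sigma>) (k \<circ> \<sigma>)"
  using assms by (auto simp: simple_eigensystem_def orthonormal_family_def inj_eq intro: inj_compose)

lemma simple_eigensystem_rescale:
  assumes "simple_eigensystem A g k" "\<And>i. c i \<noteq> 0"
  shows "simple_eigensystem A (\<lambda>i. c i *s g i) k"
proof -
  have nrm: "norm (c i *s g i) = cmod (c i) * norm (g i)" for i
  proof -
    have "complex_of_real ((norm (c i *s g i))\<^sup>2) = complex_of_real ((cmod (c i) * norm (g i))\<^sup>2)"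
      unfolding cinner_self[symmetric] cinner_scale_left cinner_scale_right
      by (simp add: cinner_self power_mult_distrib)
        (metis complex_norm_square mult.commute of_real_power)
    then show ?thesis by (simp only: of_real_eq_iff power2_eq_iff_nonneg norm_ge_zero mult_nonneg_nonneg)
  qed
  have "orthonormal_family (\<lambda>i. unit_vec (c i *s g i))"
  proof (rule orthonormal_family_unit_vec)
    show "c i *s g i \<noteq> 0" for i using assms by (simp add: simple_eigensystem_def)
    fix i j :: 'a assume "i \<noteq> j"
    then have "cinner (unit_vec (g i)) (unit_vec (g j)) = 0"
      using assms(1) by (simp add: simple_eigensystem_def orthonormal_family_def)
    then show "cinner (c i *s g i) (c j *s g j) = 0"
      using assms by (simp add: simple_eigensystem_def cinner_scale_left cinner_scale_right unit_vec_scale)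
  qed
  then show ?thesis using assms
    by (simp add: simple_eigensystem_def eigenvector_scale)
qed

section \<open>Real cross Gram matrices and symmetric representations\<close>

lemma congruence_entry:
  "(ctranspose (matrix_of_columns e) ** T ** matrix_of_columns e) $ i $ j = cinner (T *v e j) (e i)"
proof -
  have "(ctranspose (matrix_of_columns e) ** T ** matrix_of_columns e) $ i $ j
    = (ctranspose (matrix_of_columns e) *v (T *v e j)) $ i"
    unfolding matrix_vector_mul_assoc
    by (simp add: matrix_matrix_mult_def matrix_vector_mult_def matrix_of_columns_def)
  also have "\<dots> = cinner (T *v e j) (e i)"
    by (simp add: matrix_vector_mult_def ctranspose_def transpose_def matrix_of_columns_def
        cinner_def mult.commute)
  finally show ?thesis .
qed

text \<open>The source of symmetry. In the basis \<open>e\<close> the summand \<open>P\<close> is diagonal, and \<open>Q\<close> has entries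
\<open>\<Sum>p. l p * \<langle>e j, f p\<rangle> * cnj \<langle>e i, f p\<rangle>\<close>, which are symmetric in \<open>i\<close> and \<open>j\<close> when
the inner products are real. Subtracting \<open>m I\<close> from \<open>Q\<close> first removes the terms with \<open>l p = m\<close>, so
the vectors \<open>f p\<close> of one eigenspace of \<open>Q\<close> may have arbitrary inner products with \<open>e\<close>; this is
what makes a repeated eigenvalue helpful.\<close>

lemma real_gram_imp_symmetric:
  fixes T P Q :: "complex^'n^'n"
  assumes T: "\<And>x. T *v x = P *v x + Q *v x"
    and e: "orthonormal_family e" "\<And>i. P *v e i = k i *s e i"
    and f: "orthonormal_family f" "\<And>p. Q *v f p = l p *s f p"
    and real: "\<And>i p. l p = m \<or> cinner (e i) (f p) \<in> \<real>"
  shows "complex_symmetric (ctranspose (matrix_of_columns e) ** T ** matrix_of_columns e)"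
proof -
  have P: "cinner (P *v e j) (e i) = cinner (P *v e i) (e j)" for i j
    using e by (auto simp: orthonormal_family_def cinner_scale_left)
  have Q: "cinner (Q *v e j) (e i) = m * (if i = j then 1 else 0)
      + (\<Sum>p\<in>UNIV. (l p - m) * (cinner (e j) (f p) * cinner (e i) (f p)))" for i j
  proof -
    have "(l p - m) * cinner (e j) (f p) * cnj (cinner (e i) (f p))
        = (l p - m) * (cinner (e j) (f p) * cinner (e i) (f p))" for p
      using real[of p i] by (auto simp: Reals_cnj_iff)
    then have "(\<Sum>p\<in>UNIV. (l p - m) * (cinner (e j) (f p) * cinner (e i) (f p)))
        = (\<Sum>p\<in>UNIV. (l p - m) * cinner (e j) (f p) * cnj (cinner (e i) (f p)))"
      by (simp only:)
    also have "\<dots> = (\<Sum>p\<in>UNIV. l p * cinner (e j) (f p) * cnj (cinner (e i) (f p)))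
          - m * (\<Sum>p\<in>UNIV. cinner (e j) (f p) * cnj (cinner (e i) (f p)))"
      by (simp add: sum_distrib_left algebra_simps flip: sum_subtractf)
    also have "\<dots> = cinner (Q *v e j) (e i) - m * cinner (e j) (e i)"
      using matrix_vector_orthonormal_expansion[OF f] orthonormal_Parseval[OF f(1)] by metis
    also have "cinner (e j) (e i) = (if i = j then 1 else 0)"
      using e(1) by (auto simp: orthonormal_family_def)
    finally show ?thesis by (simp add: algebra_simps)
  qed
  have "cinner (Q *v e j) (e i) = cinner (Q *v e i) (e j)" for i j
    unfolding Q by (simp add: mult.commute)
  then show ?thesis
    unfolding complex_symmetric_def vec_eq_iff transpose_def congruence_entry T cinner_add_left
    using P by (simp add: congruence_entry T cinner_add_left)
qed

lemma orthonormal_family_rephase: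
  assumes "orthonormal_family e" "\<And>i. cmod (c i) = 1"
  shows "orthonormal_family (\<lambda>i. c i *s e i)"
proof -
  have "c i * cnj (c i) = 1" for i
    using assms(2)[of i] complex_norm_square[of "c i"] by simp
  then show ?thesis
    using assms(1) by (simp add: orthonormal_family_def cinner_scale_left cinner_scale_right mult.assoc[symmetric] mult.commute)
qed

lemma UECSM_I:
  assumes "orthonormal_family e"
    and "complex_symmetric (ctranspose (matrix_of_columns e) ** T ** matrix_of_columns e)"
  shows "UECSM T"
  using assms unitary_columns unfolding UECSM_def unitarily_equivalent_def by blast

text \<open>Only the phases of the cross Gram matrix are at stake, since multiplying eigenvectors by unimodular constants
changes neither orthonormality nor eigenvalues. Here \<open>d\<close> multiplies the inner products, hence its
conjugate multiplies the vectors \<open>f p\<close>.\<close>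

lemma real_gram_imp_UECSM:
  fixes T P Q :: "complex^'n^'n"
  assumes T: "\<And>x. T *v x = P *v x + Q *v x"
    and e: "orthonormal_family e" "\<And>i. P *v e i = k i *s e i"
    and f: "orthonormal_family f" "\<And>p. Q *v f p = l p *s f p"
    and cd: "\<And>i. cmod (c i) = 1" "\<And>i. cmod (d i) = 1"
    and real: "\<And>i p. l p = m \<or> c i * d p * cinner (e i) (f p) \<in> \<real>"
  shows "UECSM T"
proof -
  have one: "orthonormal_family (\<lambda>i. c i *s e i)" and onf: "orthonormal_family (\<lambda>p. cnj (d p) *s f p)"
    using e f cd by (auto intro: orthonormal_family_rephase)
  show ?thesis
  proof (rule UECSM_I[OF one], rule real_gram_imp_symmetric[OF T one _ onf])
    show "P *v (c i *s e i) = k i *s (c i *s e i)" for i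
      by (rule eigenvector_scale[OF e(2)])
    show "Q *v (cnj (d i) *s f i) = l i *s (cnj (d i) *s f i)" for i
      by (rule eigenvector_scale[OF f(2)])
    show "l p = m \<or> cinner (c i *s e i) (cnj (d p) *s f p) \<in> \<real>" for i p
      using real[of p i] by (simp add: cinner_scale_left cinner_scale_right mult_ac)
  qed
qed

section \<open>Conjugations from symmetric representations\<close>

abbreviation cnj_matrix :: "complex^'n^'m \<Rightarrow> complex^'n^'m" where
  "cnj_matrix \<equiv> map_matrix cnj"

lemma cnj_matrix_mult: "cnj_matrix (A ** B) = cnj_matrix A ** cnj_matrix B"
  by (simp add: vec_eq_iff matrix_matrix_mult_def)

lemma cnj_vec_mult: "cnj_vec (A *v x) = cnj_matrix A *v cnj_vec x"
  by (simp add: vec_eq_iff matrix_vector_mult_def cnj_vec_def)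

lemma cnj_vec_cnj_vec [simp]: "cnj_vec (cnj_vec x) = x"
  by (simp add: vec_eq_iff cnj_vec_def)

text \<open>With \<open>V = U U\<^sup>t\<close>, the entrywise conjugate of \<open>V\<close> is both its adjoint and its inverse, which makes
\<open>x \<mapsto> V (cnj x)\<close> a conjugation. It is entrywise conjugation read in the basis of columns of \<open>U\<close>,
and for entrywise conjugation \<open>C\<close>-symmetry of a matrix is symmetry.\<close>

lemma symmetric_imp_conjugation:
  fixes T U :: "complex^'n^'n"
  assumes U: "unitary U" and sym: "complex_symmetric (ctranspose U ** T ** U)"
    and C: "C = (\<lambda>x. (U ** transpose U) *v cnj_vec x)"
  shows "conjugation C" "C_symmetric C T"
proof -
  let ?V = "U ** transpose U" and ?W = "cnj_matrix (U ** transpose U)"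
  have U1: "ctranspose U ** U = mat 1" and U2: "U ** ctranspose U = mat 1"
    using U by (auto simp: unitary_def)
  have "transpose U ** cnj_matrix U = cnj_matrix (ctranspose U ** U)"
    unfolding cnj_matrix_mult by (simp add: ctranspose_def vec_eq_iff matrix_matrix_mult_def)
  then have U3: "transpose U ** cnj_matrix U = mat 1"
    by (simp add: U1 vec_eq_iff mat_def)
  have W: "?W = cnj_matrix U ** ctranspose U"
    by (simp add: cnj_matrix_mult ctranspose_def)
  have "?V ** ?W = U ** (transpose U ** cnj_matrix U) ** ctranspose U"
    by (simp only: W matrix_mul_assoc)
  then have VW: "?V ** ?W = mat 1" by (simp add: U3 U2)
  have WV: "?W ** ?V = mat 1" using VW matrix_left_right_inverse by blast
  have Vs: "ctranspose ?V = ?W"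
    by (simp add: ctranspose_def matrix_transpose_mul)
  show "conjugation C"
    unfolding conjugation_def C
  proof (intro conjI allI)
    fix x y :: "complex^'n" and a
    have "cnj_vec (x + y) = cnj_vec x + cnj_vec y" by (simp add: vec_eq_iff cnj_vec_def)
    then show "?V *v cnj_vec (x + y) = ?V *v cnj_vec x + ?V *v cnj_vec y"
      by (simp add: matrix_vector_right_distrib)
    have "cnj_vec (a *s x) = cnj a *s cnj_vec x" by (simp add: vec_eq_iff cnj_vec_def)
    then show "?V *v cnj_vec (a *s x) = cnj a *s (?V *v cnj_vec x)"
      by (simp add: vector_scalar_commute)
    show "?V *v cnj_vec (?V *v cnj_vec x) = x"
      unfolding cnj_vec_mult by (simp only: cnj_vec_cnj_vec matrix_vector_mul_assoc VW matrix_vector_mul_lid)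
    have "cinner (?V *v cnj_vec y) (?V *v cnj_vec x) = cinner (cnj_vec y) (cnj_vec x)"
      by (simp only: cinner_adjoint Vs matrix_vector_mul_assoc WV matrix_vector_mul_lid)
    also have "\<dots> = cinner x y" by (simp add: cinner_def cnj_vec_def mult.commute)
    finally show "cinner x y = cinner (?V *v cnj_vec y) (?V *v cnj_vec x)" by simp
  qed
  have "transpose (ctranspose U ** T ** U) = transpose U ** (transpose T ** cnj_matrix U)"
    by (simp add: matrix_transpose_mul ctranspose_def) (simp add: transpose_def map_matrix_def)
  then have S: "transpose U ** (transpose T ** cnj_matrix U) = ctranspose U ** T ** U"
    using sym by (simp add: complex_symmetric_def)
  have "?V ** (transpose T ** ?W) = U ** (transpose U ** (transpose T ** cnj_matrix U)) ** ctranspose U"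
    by (simp only: W matrix_mul_assoc)
  also have "\<dots> = (U ** ctranspose U) ** T ** (U ** ctranspose U)"
    unfolding S by (simp only: matrix_mul_assoc)
  also have "\<dots> = T" by (simp add: U2)
  finally have T: "?V ** (transpose T ** ?W) = T" .
  have "cnj_matrix (ctranspose T) = transpose T"
    by (simp add: ctranspose_def vec_eq_iff)
  then have "C (ctranspose T *v C x) = T *v x" for x
    unfolding C cnj_vec_mult by (simp only: cnj_vec_cnj_vec matrix_vector_mul_assoc T)
  then show "C_symmetric C T" by (simp add: C_symmetric_def)
qed

lemma C_symmetric_intertwines:
  assumes "conjugation C" "C_symmetric C T"
  shows "C (ctranspose T *v x) = T *v C x" "C (T *v x) = ctranspose T *v C x"
  using assms by (auto simp: conjugation_def C_symmetric_def)

text \<open>A conjugation commuting with \<open>A\<close> preserves its eigenspaces (the eigenvalues are real), which are lines, so it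
multiplies each \<open>g i\<close> by a constant, and likewise each \<open>h j\<close>. Since it reverses inner products, the
phase of \<open>\<langle>g i, h j\<rangle>\<close> splits into a factor depending on \<open>i\<close> and one depending on \<open>j\<close>.\<close>

lemma simple_eigensystem_conjugation_gram:
  assumes C: "conjugation C"
    and A: "ctranspose A = A" "simple_eigensystem A g k" "\<And>x. C (A *v x) = A *v C x"
    and B: "ctranspose B = B" "simple_eigensystem B h l" "\<And>x. C (B *v x) = B *v C x"
  shows "\<exists>a b. \<forall>i j. cinner (g i) (h j) = a i * b j * cnj (cinner (g i) (h j))"
proof -
  have eig: "\<exists>a. C (v i) = a *s v i"
    if "ctranspose D = D" "simple_eigensystem D v m" "\<And>x. C (D *v x) = D *v C x" for D v m i
  proof (rule simple_eigensystem_eigenvector[OF that(1,2)])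
    have ev: "D *v v i = m i *s v i" "v i \<noteq> 0" using that(2) by (auto simp: simple_eigensystem_def)
    have "D *v C (v i) = cnj (m i) *s C (v i)"
      using C ev(1) by (simp add: that(3)[symmetric] conjugation_def)
    then show "D *v C (v i) = m i *s C (v i)"
      using hermitian_eigenvalue_real[OF that(1) ev] by simp
  qed
  obtain a where a: "\<And>i. C (g i) = a i *s g i" using eig[OF A] by metis
  obtain b where b: "\<And>i. C (h i) = b i *s h i" using eig[OF B] by metis
  have "cinner (g i) (h j) = cnj (a i) * b j * cnj (cinner (g i) (h j))" for i j
  proof -
    have "cinner (g i) (h j) = cinner (C (h j)) (C (g i))" using C by (simp add: conjugation_def)
    also have "\<dots> = cnj (a i) * b j * cnj (cinner (g i) (h j))"
      by (simp add: a b cinner_scale_left cinner_scale_right cnj_cinner)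
    finally show ?thesis .
  qed
  then show ?thesis by (intro exI[of _ "\<lambda>i. cnj (a i)"] exI[of _ b]) blast
qed

text \<open>The row factors \<open>a\<close> and the column factors \<open>b\<close> cancel in a cross ratio, which is therefore equal to
its own conjugate.\<close>

lemma cross_ratio_real:
  fixes m :: "'a \<Rightarrow> 'b \<Rightarrow> complex"
  assumes m: "\<And>i j. m i j = a i * b j * cnj (m i j)"
    and nz: "m i q \<noteq> 0" "m p j \<noteq> 0"
  shows "m i j * m p q / (m p j * m i q) \<in> \<real>"
proof -
  have "a i \<noteq> 0" "b q \<noteq> 0" "a p \<noteq> 0" "b j \<noteq> 0"
    using m[of i q] m[of p j] nz by auto
  then have "m i j * m p q / (m p j * m i q) = cnj (m i j * m p q / (m p j * m i q))"
    by (subst (1 2 3 4) m) (simp add: field_simps)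
  then show ?thesis by (metis Reals_cnj_iff)
qed

section \<open>Phases\<close>

definition phase :: "complex \<Rightarrow> complex" where
  "phase z = (if z = 0 then 1 else cnj z / of_real (cmod z))"

lemma norm_phase [simp]: "cmod (phase z) = 1"
  by (simp add: phase_def norm_divide)

lemma phase_mult: "phase z * z = of_real (cmod z)"
  using complex_norm_square[of z] by (simp add: phase_def divide_simps power2_eq_square mult.commute)

lemma phase_mult_real [simp]: "phase z * z \<in> \<real>"
  by (simp add: phase_mult)

lemma UNIV_3_distinct:
  fixes i j :: 3
  assumes "i \<noteq> j"
  obtains k where "k \<noteq> i" "k \<noteq> j" "UNIV = {i, j, k}"
proof -
  have "\<exists>k\<in>{1, 2, 3}. k \<noteq> i \<and> k \<noteq> j"
    using exhaust_3[of i] exhaust_3[of j] by (elim disjE) simp_all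
  then obtain k where k: "k \<noteq> i" "k \<noteq> j" by blast
  then have "{i, j, k} = UNIV"
    using assms by (intro card_subset_eq) auto
  with k show ?thesis using that by simp
qed

text \<open>If no entry of the first row vanishes, the phases \<open>v\<close>, \<open>s\<close>, \<open>u\<close> make \<open>x\<close>, \<open>y\<close>, \<open>z\<close> real, and the
orthogonality relation expresses \<open>w\<close> through the other three up to a real factor. If an entry of the first
row vanishes, the relation puts a zero into each column, and one phase per column suffices.\<close>

lemma block_2_rephase:
  fixes x y z w :: complex
  assumes orth: "x * cnj z + y * cnj w = 0"
  shows "\<exists>u v s. cmod u = 1 \<and> cmod v = 1 \<and> cmod s = 1 \<and>
    v * x \<in> \<real> \<and> s * y \<in> \<real> \<and> u * v * z \<in> \<real> \<and> u * s * w \<in> \<real>"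
proof (cases "x = 0 \<or> y = 0")
  case True
  have xz: "x = 0 \<or> z = 0" and yw: "y = 0 \<or> w = 0" using orth True by auto
  then show ?thesis
    by (intro exI[of _ 1] exI[of _ "phase (x + z)"] exI[of _ "phase (y + w)"]) auto
next
  case False
  define u where "u = phase (phase x * z)"
  have "cnj w = - x * cnj z / y" using orth False by (simp add: field_simps eq_neg_iff_add_eq_0)
  then have "w = cnj (- x * cnj z / y)" by (metis complex_cnj_cnj)
  then have w: "w = - cnj x * z / cnj y" by simp
  have "u * phase y * w = of_real (- cmod x / cmod y) * (u * (phase x * z))"
    using False by (simp add: w phase_def field_simps)
  also have "\<dots> \<in> \<real>" unfolding u_def by (rule Reals_mult[OF Reals_of_real phase_mult_real])
  finally have "u * phase y * w \<in> \<real>" .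
  moreover have "u * phase x * z \<in> \<real>" unfolding u_def by (simp add: mult.assoc)
  ultimately show ?thesis
    by (intro exI[of _ u] exI[of _ "phase x"] exI[of _ "phase y"]) (auto simp: u_def)
qed

text \<open>A matrix that equals a real one up to unimodular diagonal factors on both sides. It is a function
of two indices so that transposition is an exchange of arguments.\<close>

definition rephasable :: "('a \<Rightarrow> 'b \<Rightarrow> complex) \<Rightarrow> bool" where
  "rephasable m \<longleftrightarrow> (\<exists>c d. (\<forall>i. cmod (c i) = 1) \<and> (\<forall>j. cmod (d j) = 1) \<and> (\<forall>i j. c i * d j * m i j \<in> \<real>))"

lemma rephasable_transpose: "rephasable (\<lambda>j i. m i j) \<Longrightarrow> rephasable m"
  unfolding rephasable_def by (metis mult.commute)

text \<open>The remaining entry of the row is then its only nonzero entry, and orthogonality of the rows clears the rest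
of its column. What is left is a two-by-two block with orthogonal rows.\<close>

lemma two_zeros_in_row_rephasable:
  fixes m :: "3 \<Rightarrow> 3 \<Rightarrow> complex"
  assumes rows: "\<And>i k. (\<Sum>p\<in>UNIV. m i p * cnj (m k p)) = (if i = k then 1 else 0)"
    and zeros: "m i p = 0" "m i q = 0" "p \<noteq> q"
  shows "rephasable m"
proof -
  obtain j where j: "j \<noteq> p" "j \<noteq> q" and U: "UNIV = {p, q, j}" using UNIV_3_distinct[OF zeros(3)] .
  have "\<exists>k. k \<noteq> i" using zeros(3) by (cases "i = p") auto
  then obtain k where k: "k \<noteq> i" ..
  obtain l where kl: "l \<noteq> i" "l \<noteq> k" and U': "UNIV = {i, k, l}"
    using UNIV_3_distinct[OF k[symmetric]] .
  have S: "(\<Sum>r\<in>UNIV. f r) = f p + f q + f j" for f :: "3 \<Rightarrow> complex"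
    unfolding U using j zeros(3) by (simp add: add_ac)
  have mij: "m i j \<noteq> 0" using rows[of i i] zeros by (auto simp: S)
  have "m r j = 0" if "r \<noteq> i" for r
    using rows[of i r] zeros mij that by (simp add: S)
  with k kl have col: "m k j = 0" "m l j = 0" by auto
  have "m k p * cnj (m l p) + m k q * cnj (m l q) = 0"
    using rows[of k l] k kl col by (simp add: S)
  from block_2_rephase[OF this] obtain u v s where
    uvs: "cmod u = 1" "cmod v = 1" "cmod s = 1" "v * m k p \<in> \<real>" "s * m k q \<in> \<real>"
      "u * v * m l p \<in> \<real>" "u * s * m l q \<in> \<real>" by blast
  define c where "c = (\<lambda>r. if r = l then u else 1)"
  define d where "d = (\<lambda>r. if r = p then v else if r = q then s else phase (m i j))"
  have "c a * d b * m a b \<in> \<real>" for a b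
  proof -
    have "a \<in> {i, k, l}" "b \<in> {p, q, j}" using U U' by auto
    then show ?thesis using j kl zeros col uvs by (auto simp: c_def d_def)
  qed
  moreover have "cmod (c a) = 1" "cmod (d a) = 1" for a
    using uvs by (auto simp: c_def d_def)
  ultimately show ?thesis unfolding rephasable_def by blast
qed

text \<open>Two zeros in different rows and columns force a third one: the inner product of their rows
reduces to a single product, which must vanish. So some two zeros share a row or a column.\<close>

lemma two_zeros_rephasable:
  fixes m :: "3 \<Rightarrow> 3 \<Rightarrow> complex"
  assumes rows: "\<And>i k. (\<Sum>p\<in>UNIV. m i p * cnj (m k p)) = (if i = k then 1 else 0)"
    and cols: "\<And>p q. (\<Sum>i\<in>UNIV. m i p * cnj (m i q)) = (if p = q then 1 else 0)"
    and zeros: "m i j = 0" "m k l = 0" "(i, j) \<noteq> (k, l)"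
  shows "rephasable m"
proof -
  consider "i = k" | "j = l" | "i \<noteq> k" "j \<noteq> l" by blast
  then show ?thesis
  proof cases
    case 1
    then show ?thesis using two_zeros_in_row_rephasable[OF rows, of i j l] zeros by auto
  next
    case 2
    then show ?thesis
      using two_zeros_in_row_rephasable[of "\<lambda>p i. m i p" j i k, OF cols] zeros
      by (auto intro: rephasable_transpose)
  next
    case 3
    obtain p where p: "p \<noteq> j" "p \<noteq> l" and U: "UNIV = {j, l, p}" using UNIV_3_distinct[OF 3(2)] .
    have "(\<Sum>r\<in>UNIV. m i r * cnj (m k r)) = m i p * cnj (m k p)"
      unfolding U using p 3 zeros by (simp add: add_ac)
    then have "m i p = 0 \<or> m k p = 0" using rows[of i k] 3 by simp
    then show ?thesis
      using two_zeros_in_row_rephasable[OF rows, of i j p] two_zeros_in_row_rephasable[OF rows, of k l p]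
        zeros p by auto
  qed
qed

section \<open>The Cartesian decomposition of \<open>T\<close>\<close>

lemma cartesian_part_hermitian:
  assumes "A = map_matrix (\<lambda>z. z / 2) (T + ctranspose T)"
    and "B = map_matrix (\<lambda>z. z / (2 * \<i>)) (T - ctranspose T)"
  shows "ctranspose A = A" "ctranspose B = B"
  unfolding assms by (simp_all add: ctranspose_def transpose_def vec_eq_iff field_simps)

lemma cartesian_part_mult:
  fixes T A B :: "complex^'n^'n"
  assumes A: "A = map_matrix (\<lambda>z. z / 2) (T + ctranspose T)"
    and B: "B = map_matrix (\<lambda>z. z / (2 * \<i>)) (T - ctranspose T)"
  shows "A *v x = (1 / 2) *s (T *v x + ctranspose T *v x)"
    and "B *v x = (1 / (2 * \<i>)) *s (T *v x + (- 1) *s (ctranspose T *v x))"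
  unfolding assms
  by (simp_all add: vec_eq_iff matrix_vector_mult_def sum_distrib_left sum_divide_distrib
      add_divide_distrib diff_divide_distrib ring_distribs mult.assoc
      flip: sum.distrib sum_subtractf sum_negf)

lemma cartesian_decomposition:
  fixes T A B :: "complex^'n^'n"
  assumes A: "A = map_matrix (\<lambda>z. z / 2) (T + ctranspose T)"
    and B: "B = map_matrix (\<lambda>z. z / (2 * \<i>)) (T - ctranspose T)"
  shows "T *v x = A *v x + map_matrix (\<lambda>z. \<i> * z) B *v x"
proof -
  have "T = A + map_matrix (\<lambda>z. \<i> * z) B"
    unfolding assms by (simp add: vec_eq_iff field_simps)
  then show ?thesis by (metis matrix_vector_mult_add_rdistrib)
qed

lemma map_matrix_scale_mult: "map_matrix (\<lambda>z. a * z) B *v x = a *s (B *v x)"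
  by (simp add: vec_eq_iff matrix_vector_mult_def sum_distrib_left mult.assoc)

text \<open>For \<open>B\<close> two sign changes cancel: \<open>C\<close> exchanges \<open>T\<close> and its adjoint, and it conjugates the
imaginary factor \<open>1 / (2 \<i>)\<close>.\<close>

lemma conjugation_commutes_cartesian:
  fixes T A B :: "complex^'n^'n"
  assumes A: "A = map_matrix (\<lambda>z. z / 2) (T + ctranspose T)"
    and B: "B = map_matrix (\<lambda>z. z / (2 * \<i>)) (T - ctranspose T)"
    and C: "conjugation C" "C_symmetric C T"
  shows "C (A *v x) = A *v C x" "C (B *v x) = B *v C x"
proof -
  have add: "C (u + v) = C u + C v" and scale: "C (a *s u) = cnj a *s C u" for a u v
    using C(1) by (auto simp: conjugation_def)
  show "C (A *v x) = A *v C x" "C (B *v x) = B *v C x"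
    unfolding cartesian_part_mult[OF A B] add scale C_symmetric_intertwines[OF C]
    by (simp_all add: add.commute vec_eq_iff field_simps)
qed

section \<open>The four parts of the criterion\<close>

text \<open>Up to a multiple of the identity \<open>Q\<close> has rank at most one: only one vector \<open>f r\<close> can lie outside
the repeated eigenspace, and the vectors \<open>e i\<close> can be multiplied by phases that make all
\<open>\<langle>e i, f r\<rangle>\<close> real.\<close>

lemma repeated_eigenvalue_UECSM:
  fixes T P Q :: "complex^3^3"
  assumes T: "\<And>x. T *v x = P *v x + Q *v x"
    and e: "orthonormal_family e" "\<And>i. P *v e i = k i *s e i"
    and f: "orthonormal_family f" "\<And>p. Q *v f p = l p *s f p"
    and l: "\<not> inj l"
  shows "UECSM T"
proof -
  obtain p q where pq: "p \<noteq> q" "l p = l q" using l by (auto simp: inj_def)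
  obtain r where r: "UNIV = {p, q, r}" using UNIV_3_distinct[OF pq(1)] .
  have "l s = l p \<or> s = r" for s using r pq(2) by (metis UNIV_I empty_iff insert_iff)
  then have real: "l s = l p \<or> phase (cinner (e i) (f r)) * 1 * cinner (e i) (f s) \<in> \<real>" for i s
  proof -
    from \<open>\<And>s. l s = l p \<or> s = r\<close>[of s] show ?thesis by (elim disjE) auto
  qed
  show ?thesis
    by (rule real_gram_imp_UECSM[OF T e f _ _ real]) auto
qed

text \<open>Once the first column is real after multiplication by \<open>c\<close> and the first row after multiplication by
\<open>d\<close>, the ratio condition carries reality over to the remaining entries. The entry \<open>m 1 1\<close> must be real
for the same to hold with \<open>i = 1\<close> or \<open>p = 1\<close>.\<close>

lemma gram_ratio_rephase:
  fixes m :: "3 \<Rightarrow> 3 \<Rightarrow> complex"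
  assumes nz: "m 1 p \<noteq> 0" "m i 1 \<noteq> 0" and m11: "m 1 1 \<in> \<real>"
    and ratio: "\<forall>i\<in>{2, 3}. \<forall>j\<in>{2, 3}. m i j / (m 1 j * m i 1) \<in> \<real>"
    and c: "c * m i 1 \<in> \<real>" and d: "d * m 1 p \<in> \<real>"
  shows "c * d * m i p \<in> \<real>"
proof -
  have "m i p / (m 1 p * m i 1) \<in> \<real>"
  proof (cases "i = 1 \<or> p = 1")
    case True
    then show ?thesis using nz m11 by (auto intro: Reals_divide)
  next
    case False
    then show ?thesis using ratio exhaust_3[of i] exhaust_3[of p] by auto
  qed
  then have "m i p / (m 1 p * m i 1) * ((c * m i 1) * (d * m 1 p)) \<in> \<real>"
    by (rule Reals_mult[OF _ Reals_mult[OF c d]])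
  also have "m i p / (m 1 p * m i 1) * ((c * m i 1) * (d * m 1 p)) = c * d * m i p"
    using nz by (simp add: field_simps)
  finally show ?thesis .
qed

lemma UECSM_imp_ratio_real:
  fixes T A B :: "complex^'n^'n"
  assumes A: "A = map_matrix (\<lambda>z. z / 2) (T + ctranspose T)"
    and B: "B = map_matrix (\<lambda>z. z / (2 * \<i>)) (T - ctranspose T)"
    and g: "simple_eigensystem A g k" and h: "simple_eigensystem B h l"
    and nz: "cinner (g i) (h q) \<noteq> 0" "cinner (g p) (h j) \<noteq> 0"
    and T: "UECSM T"
  shows "cinner (g i) (h j) * cinner (g p) (h q) / (cinner (g p) (h j) * cinner (g i) (h q)) \<in> \<real>"
proof -
  obtain U where U: "unitary U" "complex_symmetric (ctranspose U ** T ** U)"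
    using T by (auto simp: UECSM_def unitarily_equivalent_def)
  define C where "C = (\<lambda>x. (U ** transpose U) *v cnj_vec x)"
  note C = symmetric_imp_conjugation[OF U C_def]
  note comm = conjugation_commutes_cartesian[OF A B C]
  note herm = cartesian_part_hermitian[OF A B]
  obtain a b where "\<And>i j. cinner (g i) (h j) = a i * b j * cnj (cinner (g i) (h j))"
    using simple_eigensystem_conjugation_gram[OF C(1) herm(1) g comm(1) herm(2) h comm(2)] by blast
  then show ?thesis
    using cross_ratio_real[of "\<lambda>i j. cinner (g i) (h j)" a b i q p j] nz by blast
qed

lemma realigning_exists:
  "cinner (e 1) (h 1) \<in> \<real> \<Longrightarrow> \<exists>c. realigning e h c"
  by (intro exI[of _ "\<lambda>i. if i = 1 then 1 else phase (cinner (e i) (h 1))"])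
    (auto simp: realigning_def cinner_scale_left)

text \<open>The realigning constants fix the phases of the rows only; the column phases \<open>d\<close> used here serve the proof
and leave no trace in the matrix \<open>U\<close>, whose columns come from \<open>g\<close>.\<close>

lemma realigned_columns_symmetric:
  fixes T A B :: "complex^3^3"
  assumes A: "A = map_matrix (\<lambda>z. z / 2) (T + ctranspose T)"
    and B: "B = map_matrix (\<lambda>z. z / (2 * \<i>)) (T - ctranspose T)"
    and g: "simple_eigensystem A g k" and h: "simple_eigensystem B h l"
    and nz: "first_row_col_nonzero (cross_gram g h)" and m11: "cinner (g 1) (h 1) \<in> \<real>"
    and ratio: "\<forall>i\<in>{2, 3}. \<forall>j\<in>{2, 3}.
      cinner (g i) (h j) / (cinner (g 1) (h j) * cinner (g i) (h 1)) \<in> \<real>"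
    and c: "realigning (\<lambda>i. unit_vec (g i)) h c"
  shows "orthonormal_family (\<lambda>i. c i *s unit_vec (g i))"
    and "complex_symmetric (ctranspose (matrix_of_columns (\<lambda>i. c i *s unit_vec (g i))) ** T **
      matrix_of_columns (\<lambda>i. c i *s unit_vec (g i)))"
proof -
  define d where "d j = phase (cinner (g 1) (h j))" for j
  have eg: "orthonormal_family (\<lambda>i. unit_vec (g i))" "\<And>i. A *v g i = k i *s g i" "\<And>i. g i \<noteq> 0"
    and eh: "orthonormal_family (\<lambda>i. unit_vec (h i))" "\<And>i. B *v h i = l i *s h i" "\<And>i. h i \<noteq> 0"
    using g h by (auto simp: simple_eigensystem_def)
  show one: "orthonormal_family (\<lambda>i. c i *s unit_vec (g i))"
    using c by (intro orthonormal_family_rephase[OF eg(1)]) (simp add: realigning_def)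
  have onf: "orthonormal_family (\<lambda>j. cnj (d j) *s unit_vec (h j))"
    by (intro orthonormal_family_rephase[OF eh(1)]) (simp add: d_def)
  have real: "cinner (c i *s unit_vec (g i)) (cnj (d j) *s unit_vec (h j)) \<in> \<real>" for i j
  proof -
    have "of_real (1 / norm (g i)) * (c i * cinner (g i) (h 1)) \<in> \<real>"
      using c by (auto simp: realigning_def cinner_scale_left unit_vec_scale mult_ac)
    then have "of_real (norm (g i)) * (of_real (1 / norm (g i)) * (c i * cinner (g i) (h 1))) \<in> \<real>"
      by (rule Reals_mult[OF Reals_of_real])
    then have ci: "c i * cinner (g i) (h 1) \<in> \<real>"
      using eg(3)[of i] by simp
    have "c i * d j * cinner (g i) (h j) \<in> \<real>"
      using nz gram_ratio_rephase[of "\<lambda>i j. cinner (g i) (h j)", OF _ _ m11 ratio ci, of j "d j"]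
      by (auto simp: first_row_col_nonzero_def cross_gram_def d_def)
    then have "of_real (1 / norm (g i) * (1 / norm (h j))) * (c i * d j * cinner (g i) (h j)) \<in> \<real>"
      by (rule Reals_mult[OF Reals_of_real])
    then show ?thesis
      by (simp add: cinner_scale_left cinner_scale_right unit_vec_scale mult_ac)
  qed
  show "complex_symmetric (ctranspose (matrix_of_columns (\<lambda>i. c i *s unit_vec (g i))) ** T **
      matrix_of_columns (\<lambda>i. c i *s unit_vec (g i)))"
  proof (rule real_gram_imp_symmetric[OF cartesian_decomposition[OF A B] one _ onf])
    show "A *v (c i *s unit_vec (g i)) = k i *s (c i *s unit_vec (g i))" for i
      by (intro eigenvector_scale eigenvector_unit_vec eg(2))
    show "map_matrix (\<lambda>z. \<i> * z) B *v (cnj (d j) *s unit_vec (h j))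
        = (\<i> * l j) *s (cnj (d j) *s unit_vec (h j))" for j
      by (intro eigenvector_scale eigenvector_unit_vec) (simp add: map_matrix_scale_mult eh(2) vector_smult_assoc)
    show "\<i> * l j = 0 \<or> cinner (c i *s unit_vec (g i)) (cnj (d j) *s unit_vec (h j)) \<in> \<real>" for i j
      using real by blast
  qed
qed

lemma two_zero_entries_UECSM:
  fixes T A B :: "complex^3^3"
  assumes A: "A = map_matrix (\<lambda>z. z / 2) (T + ctranspose T)"
    and B: "B = map_matrix (\<lambda>z. z / (2 * \<i>)) (T - ctranspose T)"
    and g: "simple_eigensystem A g k" and h: "simple_eigensystem B h l"
    and card: "card (zero_entries (cross_gram g h)) > 1"
  shows "UECSM T"
proof -
  let ?e = "\<lambda>i. unit_vec (g i)" and ?f = "\<lambda>i. unit_vec (h i)"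
  let ?m = "\<lambda>i j. cinner (?e i) (?f j)"
  have e: "orthonormal_family ?e" "\<And>i. A *v ?e i = k i *s ?e i"
    using g by (auto simp: simple_eigensystem_def intro: eigenvector_unit_vec)
  have f: "orthonormal_family ?f" "\<And>i. map_matrix (\<lambda>z. \<i> * z) B *v ?f i = (\<i> * l i) *s ?f i"
    using h by (auto simp: simple_eigensystem_def map_matrix_scale_mult vector_smult_assoc
        eigenvector_unit_vec)
  obtain i j i' j' where "(i, j) \<in> zero_entries (cross_gram g h)"
    "(i', j') \<in> zero_entries (cross_gram g h)" "(i, j) \<noteq> (i', j')"
    using card card_le_Suc0_iff_eq[of "zero_entries (cross_gram g h)"] by fastforce
  then have zeros: "?m i j = 0" "?m i' j' = 0" "(i, j) \<noteq> (i', j')"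
    by (auto simp: zero_entries_def cross_gram_def unit_vec_scale cinner_scale_left cinner_scale_right)
  have rows: "(\<Sum>p\<in>UNIV. ?m i p * cnj (?m k p)) = (if i = k then 1 else 0)" for i k
    using orthonormal_Parseval[OF f(1), of "?e i" "?e k"] e(1) by (simp add: orthonormal_family_def)
  have cols: "(\<Sum>i\<in>UNIV. ?m i p * cnj (?m i q)) = (if p = q then 1 else 0)" for p q
    using orthonormal_Parseval[OF e(1), of "?f q" "?f p"] f(1)
    by (auto simp: orthonormal_family_def cnj_cinner mult.commute)
  have "rephasable ?m" by (rule two_zeros_rephasable[OF rows cols zeros])
  then obtain c d where cd: "\<And>i. cmod (c i) = 1" "\<And>j. cmod (d j) = 1"
    and real: "\<And>i j. c i * d j * ?m i j \<in> \<real>" unfolding rephasable_def by blast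
  show ?thesis
    by (rule real_gram_imp_UECSM[OF cartesian_decomposition[OF A B] e f cd disjI2[OF real]])
qed

lemma repeated_cartesian_UECSM:
  fixes T A B :: "complex^3^3"
  assumes A: "A = map_matrix (\<lambda>z. z / 2) (T + ctranspose T)"
    and B: "B = map_matrix (\<lambda>z. z / (2 * \<i>)) (T - ctranspose T)"
    and rep: "has_repeated_eigenvalue A \<or> has_repeated_eigenvalue B"
  shows "UECSM T"
proof -
  have inv: "matrix_of_columns e ** ctranspose (matrix_of_columns e) = mat 1"
    if "orthonormal_family e" for e :: "3 \<Rightarrow> complex^3"
    using that unitary_columns unfolding unitary_def by blast
  obtain e k where e: "orthonormal_family e" "\<And>i. A *v e i = complex_of_real (k i) *s e i"
    using hermitian_orthonormal_eigenvectors[OF cartesian_part_hermitian(1)[OF A B]] by blast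
  obtain f l where f: "orthonormal_family f" "\<And>i. B *v f i = complex_of_real (l i) *s f i"
    using hermitian_orthonormal_eigenvectors[OF cartesian_part_hermitian(2)[OF A B]] by blast
  have f': "map_matrix (\<lambda>z. \<i> * z) B *v f i = (\<i> * complex_of_real (l i)) *s f i" for i
    by (simp add: f(2) map_matrix_scale_mult vector_smult_assoc)
  note T = cartesian_decomposition[OF A B]
  note T' = trans[OF T add.commute]
  from rep show ?thesis
  proof
    assume "has_repeated_eigenvalue A"
    then have "\<not> inj (\<lambda>i. complex_of_real (k i))"
      using has_repeated_eigenvalue_iff[OF e(2) inv[OF e(1)]] by simp
    then show ?thesis by (rule repeated_eigenvalue_UECSM[OF T' f(1) f' e])
  next
    assume "has_repeated_eigenvalue B"
    then have "\<not> inj (\<lambda>i. \<i> * complex_of_real (l i))"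
      using has_repeated_eigenvalue_iff[OF f(2) inv[OF f(1)]] by (simp add: inj_def)
    then show ?thesis by (rule repeated_eigenvalue_UECSM[OF T e f(1) f'])
  qed
qed

text \<open>It suffices to move some row and some column avoiding the only possible zero to the front.\<close>

lemma reorder_first_row_col_nonzero:
  assumes "card (zero_entries (cross_gram g h)) \<le> 1"
  shows "\<exists>\<sigma> \<tau>. bij \<sigma> \<and> bij \<tau> \<and> first_row_col_nonzero (cross_gram (g \<circ> \<sigma>) (h \<circ> \<tau>))"
proof -
  obtain i j where ij: "\<And>p q. cinner (g p) (h q) = 0 \<Longrightarrow> p = i \<and> q = j"
  proof (cases "zero_entries (cross_gram g h) = {}")
    case True
    then show ?thesis using that[of 1 1] by (auto simp: zero_entries_def cross_gram_def)
  next
    case False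
    then obtain i j where "(i, j) \<in> zero_entries (cross_gram g h)" by auto
    moreover have "x = y" if "x \<in> zero_entries (cross_gram g h)" "y \<in> zero_entries (cross_gram g h)" for x y
      using that assms card_le_Suc0_iff_eq[of "zero_entries (cross_gram g h)"] by auto
    ultimately show ?thesis
      using that[of i j] by (fastforce simp: zero_entries_def cross_gram_def)
  qed
  have ex: "\<exists>\<sigma> :: 3 \<Rightarrow> 3. bij \<sigma> \<and> \<sigma> 1 \<noteq> p" for p
  proof -
    have "\<exists>q. q \<noteq> p"
      using exI[of "\<lambda>q. q \<noteq> p" 1] exI[of "\<lambda>q. q \<noteq> p" 2] by (cases "p = 1") auto
    then obtain q where "q \<noteq> p" ..
    define \<sigma> where "\<sigma> = (\<lambda>x. if x = 1 then q else if x = q then 1 else x)"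
    have "bij \<sigma>" by (rule involuntory_imp_bij) (auto simp: \<sigma>_def)
    moreover have "\<sigma> 1 \<noteq> p" using \<open>q \<noteq> p\<close> by (simp add: \<sigma>_def)
    ultimately show ?thesis by blast
  qed
  obtain \<sigma> :: "3 \<Rightarrow> 3" where "bij \<sigma>" "\<sigma> 1 \<noteq> i" using ex by blast
  moreover obtain \<tau> :: "3 \<Rightarrow> 3" where "bij \<tau>" "\<tau> 1 \<noteq> j" using ex by blast
  ultimately show ?thesis
    using ij by (intro exI[of _ \<sigma>] exI[of _ \<tau>]) (auto simp: first_row_col_nonzero_def cross_gram_def)
qed

theorem mainTheorem2:
  fixes T A B :: "complex^3^3"
  assumes A: "A = map_matrix (\<lambda>z. z / 2) (T + ctranspose T)"
    and B: "B = map_matrix (\<lambda>z. z / (2 * \<i>)) (T - ctranspose T)"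
  shows
    "(has_repeated_eigenvalue A \<or> has_repeated_eigenvalue B \<longrightarrow> UECSM T) \<and>
     (\<not> has_repeated_eigenvalue A \<and> \<not> has_repeated_eigenvalue B \<longrightarrow>
       (\<forall>g h. eigenbasis A g \<and> eigenbasis B h \<longrightarrow>
         (card (zero_entries (cross_gram g h)) > 1 \<longrightarrow> UECSM T) \<and>
         (card (zero_entries (cross_gram g h)) \<le> 1 \<longrightarrow>
           (\<exists>\<sigma> \<tau>. bij \<sigma> \<and> bij \<tau> \<and> first_row_col_nonzero (cross_gram (g \<circ> \<sigma>) (h \<circ> \<tau>))) \<and>
           (\<forall>\<sigma> \<tau>. bij \<sigma> \<and> bij \<tau> \<and> first_row_col_nonzero (cross_gram (g \<circ> \<sigma>) (h \<circ> \<tau>)) \<longrightarrow>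
             (let h' = h \<circ> \<tau>;
                  g' = rephase_first (g \<circ> \<sigma>) h';
                  M = cross_gram g' h';
                  e = (\<lambda>i. unit_vec (g' i))
              in
                (UECSM T \<longleftrightarrow>
                  (\<forall>i\<in>{2, 3}. \<forall>j\<in>{2, 3}. M $ i $ j / (M $ 1 $ j * M $ i $ 1) \<in> \<real>)) \<and>
                (UECSM T \<longrightarrow>
                  (\<exists>c. realigning e h' c) \<and>
                  (\<forall>c. realigning e h' c \<longrightarrow>
                    (let U = matrix_of_columns (\<lambda>i. c i *s e i);
                         C = (\<lambda>x. (U ** transpose U) *v cnj_vec x)
                     in
                       complex_symmetric (ctranspose U ** T ** U) \<and>
                       conjugation C \<and>
                       C_symmetric C T))))))))"
proof (intro conjI impI allI, goal_cases)
  case 1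
  then show ?case by (rule repeated_cartesian_UECSM[OF A B])
next
  case (2 g h)
  then obtain k l where "simple_eigensystem A g k" "simple_eigensystem B h l"
    using eigenbasis_simple_spectrum cartesian_part_hermitian[OF A B] by metis
  then show ?case using 2 by (intro two_zero_entries_UECSM[OF A B])
next
  case (3 g h)
  then show ?case by (intro reorder_first_row_col_nonzero)
next
  case (4 g h \<sigma> \<tau>)
  then obtain k l where "simple_eigensystem A g k" "simple_eigensystem B h l"
    using eigenbasis_simple_spectrum cartesian_part_hermitian[OF A B] by metis
  then have g\<sigma>: "simple_eigensystem A (g \<circ> \<sigma>) (k \<circ> \<sigma>)"
    and h': "simple_eigensystem B (h \<circ> \<tau>) (l \<circ> \<tau>)"
    using 4 by (auto intro: simple_eigensystem_reindex bij_is_inj)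
  define z where "z = cinner ((g \<circ> \<sigma>) 1) ((h \<circ> \<tau>) 1)"
  \<comment> \<open>Rephasing the first vector as a special case of rescaling a whole eigensystem.\<close>
  define a where "a i = (if i = 1 then complex_of_real (cmod z) / z else 1)" for i :: 3
  define g' where "g' = rephase_first (g \<circ> \<sigma>) (h \<circ> \<tau>)"
  define m where "m i j = cinner (g' i) ((h \<circ> \<tau>) j)" for i j
  have nz0: "\<And>j. cinner ((g \<circ> \<sigma>) 1) ((h \<circ> \<tau>) j) \<noteq> 0" "\<And>i. cinner ((g \<circ> \<sigma>) i) ((h \<circ> \<tau>) 1) \<noteq> 0"
    using 4 by (auto simp: first_row_col_nonzero_def cross_gram_def)
  have z: "z \<noteq> 0" using nz0(1) by (simp add: z_def)
  then have a: "a i \<noteq> 0" for i by (simp add: a_def)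
  have g'_eq: "g' = (\<lambda>i. a i *s (g \<circ> \<sigma>) i)"
    by (auto simp: g'_def rephase_first_def a_def z_def)
  have g': "simple_eigensystem A g' (k \<circ> \<sigma>)"
    unfolding g'_eq by (rule simple_eigensystem_rescale[OF g\<sigma> a])
  have nz: "m 1 j \<noteq> 0" "m i 1 \<noteq> 0" for i j
    using nz0 a by (auto simp: m_def g'_eq cinner_scale_left)
  have m11: "m 1 1 \<in> \<real>"
    using z by (simp add: m_def g'_eq cinner_scale_left a_def z_def)
  have nz': "first_row_col_nonzero (cross_gram g' (h \<circ> \<tau>))"
    using nz by (simp add: first_row_col_nonzero_def cross_gram_def m_def)
  have ratio: "m i j / (m 1 j * m i 1) \<in> \<real>" if "UECSM T" for i j
  proof -
    have "m i j * m 1 1 / (m 1 j * m i 1) \<in> \<real>"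
      using UECSM_imp_ratio_real[OF A B g' h' _ _ that, of i 1 1 j] nz by (simp add: m_def)
    then have "m i j * m 1 1 / (m 1 j * m i 1) / m 1 1 \<in> \<real>" using m11 by (rule Reals_divide)
    then show ?thesis using nz by simp
  qed
  let ?e = "\<lambda>i. unit_vec (g' i)"
  have "cinner (?e 1) ((h \<circ> \<tau>) 1) = of_real (1 / norm (g' 1)) * m 1 1"
    by (simp only: unit_vec_scale cinner_scale_left m_def)
  also have "\<dots> \<in> \<real>" using m11 by (intro Reals_mult) auto
  finally have ex: "\<exists>c. realigning ?e (h \<circ> \<tau>) c" by (rule realigning_exists)
  have sym: "orthonormal_family (\<lambda>i. c i *s ?e i)"
    "complex_symmetric (ctranspose (matrix_of_columns (\<lambda>i. c i *s ?e i)) ** T **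
      matrix_of_columns (\<lambda>i. c i *s ?e i))"
    if "\<forall>i\<in>{2, 3}. \<forall>j\<in>{2, 3}. m i j / (m 1 j * m i 1) \<in> \<real>" "realigning ?e (h \<circ> \<tau>) c" for c
    using realigned_columns_symmetric[OF A B g' h' nz' _ _ that(2)] m11 that(1)
    unfolding m_def by blast+
  have iff: "UECSM T \<longleftrightarrow> (\<forall>i\<in>{2, 3}. \<forall>j\<in>{2, 3}. m i j / (m 1 j * m i 1) \<in> \<real>)"
  proof
    assume real: "\<forall>i\<in>{2, 3}. \<forall>j\<in>{2, 3}. m i j / (m 1 j * m i 1) \<in> \<real>"
    from ex obtain c where c: "realigning ?e (h \<circ> \<tau>) c" ..
    show "UECSM T" by (rule UECSM_I[OF sym[OF real c]])
  qed (use ratio in blast)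
  have conj: "let U = matrix_of_columns (\<lambda>i. c i *s ?e i); C = (\<lambda>x. (U ** transpose U) *v cnj_vec x)
      in complex_symmetric (ctranspose U ** T ** U) \<and> conjugation C \<and> C_symmetric C T"
    if "UECSM T" "realigning ?e (h \<circ> \<tau>) c" for c
  proof -
    have "unitary (matrix_of_columns (\<lambda>i. c i *s ?e i))"
      unfolding unitary_columns by (rule sym(1)[OF _ that(2)]) (use ratio[OF that(1)] in blast)
    moreover have "complex_symmetric (ctranspose (matrix_of_columns (\<lambda>i. c i *s ?e i)) ** T **
        matrix_of_columns (\<lambda>i. c i *s ?e i))"
      by (rule sym(2)[OF _ that(2)]) (use ratio[OF that(1)] in blast)
    ultimately show ?thesis
      unfolding Let_def using symmetric_imp_conjugation[OF _ _ refl, of "matrix_of_columns (\<lambda>i. c i *s ?e i)" T] by blast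
  qed
  show ?case
    unfolding Let_def g'_def[symmetric] cross_gram_def vec_lambda_beta m_def[symmetric]
    using iff ex conj[unfolded Let_def] by (intro conjI impI allI) blast+
qed

end
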